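(* Let $G$ be a VPT graph and let $h\geq 3$ be an integer. Then $G\in[h,2,1]$ if and only if the branch graph $B(G/C)$ is $h$-colorable for every clique $C$ of $G$. Moreover, the implication "$G\in[h,2,1]\Rightarrow B(G/C)$ is $h$-colorable for every clique $C$ of $G$" also holds for $h=2$.
   Context: All graphs are finite, simple and connected. A clique is a maximal complete set of vertices. An $(h,s,t)$-representation of a graph $G$ is a collection of subtrees $(T_v)_{v\in V(G)}$ of a tree $T$ such that (i) $T$ has maximum degree at most $h$, (ii) every subtree $T_v$ has maximum degree at most $s$, and (iii) two distinct vertices $v,w$ are adjacent in $G$ iff $T_v$ and $T_w$ have at least $t$ vertices in common. $[h,s,t]$ denotes the class of graphs having an $(h,s,t)$-representation; $h=\infty$ or $s=\infty$ means no degree restriction. Thus $[h,2,1]$ is the class of graphs that are vertex-intersection graphs of paths in a tree of maximum degree at most $h$, and VPT $=[\infty,2,1]$. For a clique $C$ of $G$, the branch graph $B(G/C)$ has vertex set the vertices of $V(G)\setminus C$ adjacent to some vertex of $C$, and two such vertices $v,w$ are adjacent in $B(G/C)$ iff (1) $vw\notin E(G)$; (2) some vertex of $C$ is adjacent to both $v$ and $w$; and (3) there exist $v',w'\in C$ with $v'$ adjacent to $v$ but not to $w$, and $w'$ adjacent to $w$ but not to $v$. *)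

theory Defs
  imports Main "HOL-Library.Extended_Nat"
begin

definition simple_graph :: "'a set \<Rightarrow> ('a \<Rightarrow> 'a \<Rightarrow> bool) \<Rightarrow> bool" where
  "simple_graph V E \<longleftrightarrow> finite V \<and> (\<forall>x y. E x y \<longrightarrow> x \<in> V \<and> y \<in> V)
     \<and> (\<forall>x y. E x y \<longrightarrow> E y x) \<and> (\<forall>x. \<not> E x x)"

definition connected_graph :: "'a set \<Rightarrow> ('a \<Rightarrow> 'a \<Rightarrow> bool) \<Rightarrow> bool" where
  "connected_graph V E \<longleftrightarrow> V \<noteq> {} \<and>
     (\<forall>x\<in>V. \<forall>y\<in>V. (\<lambda>u w. E u w \<and> u \<in> V \<and> w \<in> V)\<^sup>*\<^sup>* x y)"

definition graph :: "'a set \<Rightarrow> ('a \<Rightarrow> 'a \<Rightarrow> bool) \<Rightarrow> bool" where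
  "graph V E \<longleftrightarrow> simple_graph V E \<and> connected_graph V E"

definition is_cycle :: "'b set \<Rightarrow> ('b \<Rightarrow> 'b \<Rightarrow> bool) \<Rightarrow> 'b list \<Rightarrow> bool" where
  "is_cycle N A xs \<longleftrightarrow> length xs \<ge> 3 \<and> distinct xs \<and> set xs \<subseteq> N
     \<and> (\<forall>i. Suc i < length xs \<longrightarrow> A (xs ! i) (xs ! Suc i)) \<and> A (last xs) (hd xs)"

definition is_tree :: "'b set \<Rightarrow> ('b \<Rightarrow> 'b \<Rightarrow> bool) \<Rightarrow> bool" where
  "is_tree N A \<longleftrightarrow> simple_graph N A \<and> connected_graph N A \<and> (\<nexists>xs. is_cycle N A xs)"

definition deg_in :: "'b set \<Rightarrow> ('b \<Rightarrow> 'b \<Rightarrow> bool) \<Rightarrow> 'b \<Rightarrow> nat" where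
  "deg_in S A x = card {y \<in> S. A x y}"

(* S is (the vertex set of) a subtree of the tree (N,A): a nonempty vertex set inducing a
   connected subgraph; in a tree every subtree is the induced subgraph on its vertices *)
definition is_subtree :: "'b set \<Rightarrow> ('b \<Rightarrow> 'b \<Rightarrow> bool) \<Rightarrow> 'b set \<Rightarrow> bool" where
  "is_subtree N A S \<longleftrightarrow> S \<subseteq> N \<and> connected_graph S (\<lambda>x y. A x y \<and> x \<in> S \<and> y \<in> S)"

definition hst_rep :: "enat \<Rightarrow> enat \<Rightarrow> nat \<Rightarrow> 'a set \<Rightarrow> ('a \<Rightarrow> 'a \<Rightarrow> bool)
    \<Rightarrow> 'b set \<Rightarrow> ('b \<Rightarrow> 'b \<Rightarrow> bool) \<Rightarrow> ('a \<Rightarrow> 'b set) \<Rightarrow> bool" where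
  "hst_rep h s t V E N A Tv \<longleftrightarrow> is_tree N A
     \<and> (\<forall>x\<in>N. enat (deg_in N A x) \<le> h)
     \<and> (\<forall>v\<in>V. is_subtree N A (Tv v) \<and> (\<forall>x\<in>Tv v. enat (deg_in (Tv v) A x) \<le> s))
     \<and> (\<forall>v\<in>V. \<forall>w\<in>V. v \<noteq> w \<longrightarrow> (E v w \<longleftrightarrow> card (Tv v \<inter> Tv w) \<ge> t))"

(* the class [h,s,t]; host trees are taken with vertices in nat (every finite tree is
   isomorphic to one on nat) *)
definition in_hst :: "enat \<Rightarrow> enat \<Rightarrow> nat \<Rightarrow> 'a set \<Rightarrow> ('a \<Rightarrow> 'a \<Rightarrow> bool) \<Rightarrow> bool" where
  "in_hst h s t V E \<longleftrightarrow> (\<exists>(N::nat set) A Tv. hst_rep h s t V E N A Tv)"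

definition VPT :: "'a set \<Rightarrow> ('a \<Rightarrow> 'a \<Rightarrow> bool) \<Rightarrow> bool" where
  "VPT V E \<longleftrightarrow> in_hst \<infinity> 2 1 V E"

definition complete_set :: "'a set \<Rightarrow> ('a \<Rightarrow> 'a \<Rightarrow> bool) \<Rightarrow> 'a set \<Rightarrow> bool" where
  "complete_set V E C \<longleftrightarrow> C \<subseteq> V \<and> (\<forall>x\<in>C. \<forall>y\<in>C. x \<noteq> y \<longrightarrow> E x y)"

definition clique :: "'a set \<Rightarrow> ('a \<Rightarrow> 'a \<Rightarrow> bool) \<Rightarrow> 'a set \<Rightarrow> bool" where
  "clique V E C \<longleftrightarrow> complete_set V E C \<and> (\<forall>D. complete_set V E D \<and> C \<subseteq> D \<longrightarrow> D = C)"

definition branch_vertices :: "'a set \<Rightarrow> ('a \<Rightarrow> 'a \<Rightarrow> bool) \<Rightarrow> 'a set \<Rightarrow> 'a set" where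
  "branch_vertices V E C = {v \<in> V - C. \<exists>c\<in>C. E v c}"

definition branch_adj :: "'a set \<Rightarrow> ('a \<Rightarrow> 'a \<Rightarrow> bool) \<Rightarrow> 'a set \<Rightarrow> 'a \<Rightarrow> 'a \<Rightarrow> bool" where
  "branch_adj V E C v w \<longleftrightarrow> v \<in> branch_vertices V E C \<and> w \<in> branch_vertices V E C
     \<and> \<not> E v w \<and> v \<noteq> w
     \<and> (\<exists>c\<in>C. E c v \<and> E c w)
     \<and> (\<exists>v'\<in>C. \<exists>w'\<in>C. E v' v \<and> \<not> E v' w \<and> E w' w \<and> \<not> E w' v)"

definition colorable :: "'a set \<Rightarrow> ('a \<Rightarrow> 'a \<Rightarrow> bool) \<Rightarrow> nat \<Rightarrow> bool" where
  "colorable V E k \<longleftrightarrow> (\<exists>f :: 'a \<Rightarrow> nat. (\<forall>v\<in>V. f v < k)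
     \<and> (\<forall>v\<in>V. \<forall>w\<in>V. E v w \<longrightarrow> f v \<noteq> f w))"

end

theory Submission
  imports Defs
begin

text \<open>
  Necessity: by the Helly property a clique \<open>C\<close> consists of all paths through some host vertex \<open>q\<close>.
  Root the host tree at \<open>q\<close> and colour a branch vertex by the child of \<open>q\<close> above its path. Two branch
  vertices below the same child that share a neighbour in \<open>C\<close> have tops on a common descending chain,
  so one of them dominates the other inside \<open>C\<close> and they are not adjacent in the branch graph.

  Sufficiency: contract host edges until no bag (the set of paths through a host vertex) is contained
  in a neighbouring one; then every bag is a clique. At each host vertex \<open>q\<close> the colouring of the
  branch graph yields an \<open>h\<close>-colouring of the neighbours of \<open>q\<close> in which no path passes through \<open>q\<close>
  and two neighbours of the same colour. If \<open>q\<close> has more than \<open>h\<close> neighbours, two of them have the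
  same colour; hang both on a new vertex attached to \<open>q\<close>. The new vertex has degree \<open>3 \<le> h\<close>, the
  degree of \<open>q\<close> drops, and the colourings survive, so the process ends with maximum degree at most \<open>h\<close>.
\<close>

section \<open>Rooted trees\<close>

text \<open>The rank \<open>d\<close> only has to drop towards the root; it need not be the
  distance. This slack lets contraction keep the old ranks and splitting place a vertex between
  \<open>q\<close> and its children.\<close>

locale rooted =
  fixes N :: "'b set" and r :: 'b and par :: "'b \<Rightarrow> 'b" and d :: "'b \<Rightarrow> nat"
  assumes finite_N: "finite N"
    and root_in: "r \<in> N"
    and par_in: "\<And>x. x \<in> N \<Longrightarrow> x \<noteq> r \<Longrightarrow> par x \<in> N"
    and d_par: "\<And>x. x \<in> N \<Longrightarrow> x \<noteq> r \<Longrightarrow> d (par x) < d x"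
begin

definition adj :: "'b \<Rightarrow> 'b \<Rightarrow> bool" where
  "adj x y \<longleftrightarrow> x \<in> N \<and> y \<in> N \<and> (x \<noteq> r \<and> y = par x \<or> y \<noteq> r \<and> x = par y)"

text \<open>Directed from parent to child, so that \<open>pr\<^sup>*\<^sup>*\<close> is the ancestor
  order.\<close>

definition pr :: "'b \<Rightarrow> 'b \<Rightarrow> bool" where
  "pr x y \<longleftrightarrow> y \<in> N \<and> y \<noteq> r \<and> x = par y"

text \<open>Connectedness in parent form: by \<open>is_subtree_iff\<close> the subtrees are exactly
  the subsets of \<open>N\<close> with a top. Being a condition on single vertices, it can be
  rechecked by cases after surgery on \<open>par\<close>.\<close>

definition top :: "'b set \<Rightarrow> 'b \<Rightarrow> bool" where
  "top S t \<longleftrightarrow> t \<in> S \<and> (\<forall>x\<in>S. x \<noteq> t \<longrightarrow> x \<noteq> r \<and> par x \<in> S)"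

lemma pr_less: "pr x y \<Longrightarrow> d x < d y"
  using d_par by (auto simp: pr_def)

lemma anc_le: "pr\<^sup>*\<^sup>* x y \<Longrightarrow> d x \<le> d y"
  by (induction rule: rtranclp_induct) (auto dest: pr_less)

lemma anc_neq_less: "pr\<^sup>*\<^sup>* x y \<Longrightarrow> x \<noteq> y \<Longrightarrow> d x < d y"
  by (metis anc_le le_less_trans pr_less rtranclp.cases leD le_less_linear)

lemma anc_antisym: "pr\<^sup>*\<^sup>* x y \<Longrightarrow> pr\<^sup>*\<^sup>* y x \<Longrightarrow> x = y"
  by (meson anc_le anc_neq_less leD)

lemma root_anc: "x \<in> N \<Longrightarrow> pr\<^sup>*\<^sup>* r x"
proof (induction "d x" arbitrary: x rule: less_induct)
  case less
  show ?case
  proof (cases "x = r")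
    case False
    then have "pr\<^sup>*\<^sup>* r (par x)" "pr (par x) x"
      using less d_par par_in by (auto simp: pr_def)
    then show ?thesis by (rule rtranclp.rtrancl_into_rtrancl)
  qed simp
qed

lemma simple_graph_adj: "simple_graph N adj"
  using finite_N d_par by (fastforce simp: simple_graph_def adj_def)

text \<open>On a cycle, a vertex of largest rank has two distinct neighbours, and each of them would
  have to be its parent.\<close>

lemma acyclic_adj: "\<not> is_cycle N adj xs"
proof
  assume c: "is_cycle N adj xs"
  let ?n = "length xs"
  have n: "?n \<ge> 3" and dist: "distinct xs" and sub: "set xs \<subseteq> N"
    and st: "\<And>i. Suc i < ?n \<Longrightarrow> adj (xs ! i) (xs ! Suc i)" and cl: "adj (last xs) (hd xs)"
    using c by (auto simp: is_cycle_def)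
  have ne: "xs \<noteq> []" using n by auto
  have sym: "adj x y \<Longrightarrow> adj y x" for x y by (auto simp: adj_def)
  have "Max (d ` set xs) \<in> d ` set xs" using ne by (intro Max_in) auto
  then obtain m where m: "m \<in> set xs" "d m = Max (d ` set xs)" by auto
  have mx: "d y \<le> d m" if "y \<in> set xs" for y using that m by simp
  have up: "y = par m" if "y \<in> set xs" "adj m y" for y
    using that mx[of y] d_par[of y] by (auto simp: adj_def)
  obtain i where i: "i < ?n" "m = xs ! i" using m by (metis in_set_conv_nth)
  have ends: "hd xs = xs ! 0" "last xs = xs ! (?n - 1)"
    using ne by (simp_all add: hd_conv_nth last_conv_nth)
  have "\<exists>j k. j < ?n \<and> k < ?n \<and> j \<noteq> k \<and> adj m (xs ! j) \<and> adj m (xs ! k)"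
  proof -
    consider "i = 0" | "i = ?n - 1" "i \<noteq> 0" | "i \<noteq> 0" "Suc i < ?n" using i by linarith
    then show ?thesis
    proof cases
      case 1
      have "adj m (xs ! 1)" using st[of 0] i 1 n by simp
      moreover have "adj m (xs ! (?n - 1))" using cl sym ends i 1 by simp
      ultimately show ?thesis using n by (intro exI[of _ 1] exI[of _ "?n - 1"]) auto
    next
      case 2
      then have e: "Suc (?n - 2) = i" using n by auto
      then have "adj m (xs ! (?n - 2))" using st[of "?n - 2"] i sym by simp
      moreover have "adj m (xs ! 0)" using cl ends i 2 by simp
      ultimately show ?thesis using n by (intro exI[of _ "?n - 2"] exI[of _ 0]) auto
    next
      case 3
      have "adj m (xs ! (i - 1))" using st[of "i - 1"] 3 i sym by simp
      moreover have "adj m (xs ! Suc i)" using st[of i] 3 i by simp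
      ultimately show ?thesis using i 3 by (intro exI[of _ "i - 1"] exI[of _ "Suc i"]) auto
    qed
  qed
  then show False using up dist by (metis nth_eq_iff_index_eq nth_mem)
qed

lemma connected_of_top:
  assumes "S \<subseteq> N" "top S t"
  shows "connected_graph S (\<lambda>x y. adj x y \<and> x \<in> S \<and> y \<in> S)"
proof -
  let ?R = "\<lambda>u w. (adj u w \<and> u \<in> S \<and> w \<in> S) \<and> u \<in> S \<and> w \<in> S"
  have sy: "symp ?R" by (auto simp: symp_def adj_def)
  have to: "?R\<^sup>*\<^sup>* x t" if "x \<in> S" for x
    using that
  proof (induction "d x" arbitrary: x rule: less_induct)
    case less
    show ?case
    proof (cases "x = t")
      case False
      then have p: "x \<in> N" "x \<noteq> r" "par x \<in> S" using less.prems assms by (auto simp: top_def)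
      then have "?R x (par x)" using assms less.prems by (auto simp: adj_def)
      moreover have "?R\<^sup>*\<^sup>* (par x) t" using less.hyps d_par p by blast
      ultimately show ?thesis by (rule converse_rtranclp_into_rtranclp)
    qed simp
  qed
  have "?R\<^sup>*\<^sup>* x y" if "x \<in> S" "y \<in> S" for x y
    using to[OF that(1)] to[OF that(2)] sympD[OF symp_rtranclp[OF sy]] by (meson rtranclp_trans)
  then show ?thesis using assms by (auto simp: connected_graph_def top_def)
qed

text \<open>A vertex of \<open>S\<close> that is the root or has its parent outside \<open>S\<close>
  lies above all of \<open>S\<close>, so by antisymmetry there is only one; a vertex of least rank
  is such a vertex.\<close>

lemma top_of_connected:
  assumes S: "S \<subseteq> N" and con: "connected_graph S (\<lambda>x y. adj x y \<and> x \<in> S \<and> y \<in> S)"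
  shows "\<exists>t. top S t"
proof -
  let ?R = "\<lambda>u w. (adj u w \<and> u \<in> S \<and> w \<in> S) \<and> u \<in> S \<and> w \<in> S"
  \<comment> \<open>A walk inside \<open>S\<close> that starts at such an \<open>x\<close> stays
    among its descendants, because no step inside \<open>S\<close> goes up from \<open>x\<close>
    itself.\<close>
  have below: "pr\<^sup>*\<^sup>* x y" if x: "x \<in> S" "x = r \<or> par x \<notin> S" and y: "y \<in> S" for x y
  proof -
    have "?R\<^sup>*\<^sup>* x y" using con x y by (auto simp: connected_graph_def)
    then show ?thesis
    proof (induction rule: rtranclp_induct)
      case (step y z)
      then consider "y \<noteq> r" "z = par y" | "pr y z" by (auto simp: adj_def pr_def)
      then show ?case
      proof cases
        case 1
        then have "x \<noteq> y" using x step by auto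
        then obtain u where "pr\<^sup>*\<^sup>* x u" "pr u y" using step.IH by (metis rtranclp.cases)
        then show ?thesis using 1 by (metis pr_def)
      qed (use step.IH in auto)
    qed simp
  qed
  have "S \<noteq> {}" using con by (simp add: connected_graph_def)
  moreover have "finite S" using S finite_N finite_subset by blast
  ultimately obtain t where t: "t \<in> S" "\<And>x. x \<in> S \<Longrightarrow> d t \<le> d x"
    by (metis arg_min_if_finite(1) arg_min_least)
  have tt: "t = r \<or> par t \<notin> S" using t(2)[of "par t"] t(1) d_par[of t] S by auto
  have "x \<noteq> r \<and> par x \<in> S" if "x \<in> S" "x \<noteq> t" for x
    using below[OF t(1) tt that(1)] below[OF that(1) _ t(1)] anc_antisym that(2) by blast
  then show ?thesis using t by (auto simp: top_def)
qed

lemma is_subtree_iff: "is_subtree N adj S \<longleftrightarrow> S \<subseteq> N \<and> (\<exists>t. top S t)"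
  unfolding is_subtree_def using connected_of_top top_of_connected by blast

lemma is_tree_adj: "is_tree N adj"
proof -
  have "top N r" using root_in par_in by (auto simp: top_def)
  then have "connected_graph N (\<lambda>x y. adj x y \<and> x \<in> N \<and> y \<in> N)"
    by (intro connected_of_top) auto
  moreover have "(\<lambda>x y. adj x y \<and> x \<in> N \<and> y \<in> N) = adj" by (auto simp: adj_def fun_eq_iff)
  ultimately show ?thesis using simple_graph_adj acyclic_adj by (auto simp: is_tree_def)
qed

lemma top_anc:
  assumes "S \<subseteq> N" "top S t" "x \<in> S"
  shows "pr\<^sup>*\<^sup>* t x"
  using assms(3)
proof (induction "d x" arbitrary: x rule: less_induct)
  case less
  show ?case
  proof (cases "x = t")
    case False
    then have "pr (par x) x" "par x \<in> S" using less.prems assms by (auto simp: top_def pr_def)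
    then show ?thesis using less.hyps pr_less by (meson rtranclp.rtrancl_into_rtrancl)
  qed simp
qed

text \<open>Climbing from \<open>z\<close> stays in \<open>S\<close> up to \<open>t\<close>, and the
  rank condition forbids passing \<open>t\<close> before \<open>x\<close> is reached.\<close>

lemma anc_in:
  assumes "top S t" "pr\<^sup>*\<^sup>* x z" "z \<in> S" "d t \<le> d x"
  shows "x \<in> S"
  using assms(2,3)
proof (induction rule: rtranclp_induct)
  case (step y z)
  have "d x < d z" using step anc_le pr_less by (meson le_less_trans)
  then have "z \<noteq> t" using assms(4) by auto
  then have "y \<in> S" using step assms(1) by (auto simp: top_def pr_def)
  then show ?case using step by blast
qed simp

lemma top_root: "S \<subseteq> N \<Longrightarrow> top S t \<Longrightarrow> r \<in> S \<Longrightarrow> t = r"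
  by (auto simp: top_def)

text \<open>The top of largest rank lies in every member: it is an ancestor of a common vertex, so
  \<open>anc_in\<close> applies in the other subtree.\<close>

lemma helly:
  assumes "finite F" "F \<noteq> {}" and sub: "\<And>S. S \<in> F \<Longrightarrow> S \<subseteq> N \<and> (\<exists>t. top S t)"
    and meet: "\<And>S S'. S \<in> F \<Longrightarrow> S' \<in> F \<Longrightarrow> S \<inter> S' \<noteq> {}"
  shows "\<exists>z. \<forall>S\<in>F. z \<in> S"
proof -
  obtain tp where tp: "\<And>S. S \<in> F \<Longrightarrow> top S (tp S)" using sub by metis
  have "Max ((\<lambda>S. d (tp S)) ` F) \<in> (\<lambda>S. d (tp S)) ` F" using assms(1,2) by (intro Max_in) auto
  then obtain S where S: "S \<in> F" "d (tp S) = Max ((\<lambda>S. d (tp S)) ` F)" by auto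
  have "tp S \<in> S'" if S': "S' \<in> F" for S'
  proof -
    obtain z where z: "z \<in> S" "z \<in> S'" using meet[OF S(1) S'] by auto
    have "pr\<^sup>*\<^sup>* (tp S) z" using top_anc sub tp S z by blast
    moreover have "d (tp S') \<le> d (tp S)" using S S' assms(1) by simp
    ultimately show ?thesis using anc_in tp S' z by blast
  qed
  then show ?thesis by blast
qed

lemma adj_sym: "adj x y \<Longrightarrow> adj y x"
  by (auto simp: adj_def)

text \<open>Below a child of the root, a path that contains the root cannot fork: a vertex with two
  children on the path would have these and its parent as three neighbours.\<close>

lemma path_below_linear:
  assumes S: "S \<subseteq> N" "top S r" and deg: "\<And>x. x \<in> S \<Longrightarrow> deg_in S adj x \<le> 2"
    and b: "b \<noteq> r" and xy: "pr\<^sup>*\<^sup>* b x" "pr\<^sup>*\<^sup>* b y" "x \<in> S" "y \<in> S"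
  shows "pr\<^sup>*\<^sup>* x y \<or> pr\<^sup>*\<^sup>* y x"
  using xy(1,3)
proof (induction rule: rtranclp_induct)
  case base
  then show ?case using xy by simp
next
  case (step x z)
  have zN: "z \<in> N" "z \<noteq> r" "x = par z" using step by (auto simp: pr_def)
  have xS: "x \<in> S" using S step zN by (auto simp: top_def)
  have xr: "x \<noteq> r"
  proof
    assume "x = r"
    then have "pr\<^sup>*\<^sup>* b r" using step by simp
    then show False using b by (cases rule: rtranclp.cases) (auto simp: pr_def)
  qed
  from step.IH[OF xS] show ?case
  proof
    assume "pr\<^sup>*\<^sup>* y x"
    then show ?thesis using step by (meson rtranclp.rtrancl_into_rtrancl)
  next
    assume "pr\<^sup>*\<^sup>* x y"
    then show ?thesis
    proof (cases rule: converse_rtranclpE)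
      case base
      then show ?thesis using step by blast
    next
      case (step z')
      have z': "z' \<in> N" "z' \<noteq> r" "x = par z'" using step by (auto simp: pr_def)
      have "d r \<le> d z'" using anc_le root_anc z' by blast
      then have z'S: "z' \<in> S" using anc_in[OF S(2) step(2) xy(4)] by blast
      have "z = z'"
      proof (rule ccontr)
        assume ne: "z \<noteq> z'"
        have "d (par x) < d x" "d x < d z" "d x < d z'" using d_par[of x] d_par[of z] d_par[of z'] zN z' xr xS S by auto
        then have "par x \<noteq> z" "par x \<noteq> z'" by auto
        then have "card {par x, z, z'} = 3" using ne by simp
        moreover have "{par x, z, z'} \<subseteq> {y \<in> S. adj x y}"
          using xr xS S zN z' z'S \<open>z \<in> S\<close> par_in[of x] by (auto simp: adj_def top_def)
        moreover have "finite S" using S finite_N finite_subset by blast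
        ultimately have "3 \<le> deg_in S adj x"
          unfolding deg_in_def using card_mono[of "{y \<in> S. adj x y}" "{par x, z, z'}"] by simp
        then show False using deg[OF xS] by simp
      qed
      then show ?thesis using step by blast
    qed
  qed
qed

lemma child_above:
  assumes "x \<in> N" "x \<noteq> r"
  shows "\<exists>b. adj r b \<and> b \<noteq> r \<and> pr\<^sup>*\<^sup>* b x"
proof -
  obtain b where b: "pr r b" "pr\<^sup>*\<^sup>* b x"
    using root_anc[OF assms(1)] assms(2) by (metis converse_rtranclpE)
  then have "adj r b" "b \<noteq> r" using root_in unfolding pr_def adj_def by blast+
  then show ?thesis using b by blast
qed

end

section \<open>Rooting an arbitrary finite tree\<close>

lemma distinct_walk:
  assumes "R\<^sup>*\<^sup>* u w"
  shows "\<exists>xs. xs \<noteq> [] \<and> distinct xs \<and> hd xs = u \<and> last xs = w \<and> successively R xs"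
  using assms
proof (induction rule: rtranclp_induct)
  case base
  show ?case by (intro exI[of _ "[u]"]) auto
next
  case (step y z)
  then obtain xs where xs: "xs \<noteq> []" "distinct xs" "hd xs = u" "last xs = y" "successively R xs"
    by blast
  show ?case
  proof (cases "z \<in> set xs")
    case True
    \<comment> \<open>A return to \<open>z\<close> cuts the walk off at the earlier visit.\<close>
    then obtain as bs where "xs = as @ z # bs" by (meson split_list)
    then have "xs = (as @ [z]) @ bs" by simp
    then show ?thesis using xs
      by (intro exI[of _ "as @ [z]"])
        (metis append_is_Nil_conv distinct_append hd_append2 last_snoc list.discI successively_append_iff)
  next
    case False
    then show ?thesis using xs step(2)
      by (intro exI[of _ "xs @ [z]"]) (auto simp: successively_append_iff)
  qed
qed

text \<open>A maximal vertex set containing \<open>r\<close> on which \<open>A\<close> is a rooted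
  tree must be all of \<open>N\<close>: an outside vertex adjacent to it has just one neighbour in
  it, since two would close a cycle, and can be hung below that neighbour.\<close>

lemma tree_rooted:
  assumes T: "is_tree N A" and r: "r \<in> N"
  shows "\<exists>par d. rooted N r par d \<and> A = rooted.adj N r par"
proof -
  have sg: "simple_graph N A" and cg: "connected_graph N A" and ac: "\<And>xs. \<not> is_cycle N A xs"
    using T by (auto simp: is_tree_def)
  have fin: "finite N" and AN: "\<And>x y. A x y \<Longrightarrow> x \<in> N \<and> y \<in> N" and sym: "\<And>x y. A x y \<Longrightarrow> A y x"
    and irr: "\<And>x. \<not> A x x"
    using sg by (auto simp: simple_graph_def)
  define good where "good M \<longleftrightarrow> M \<subseteq> N \<and> (\<exists>par d. rooted M r par d \<and>
     (\<forall>x\<in>M. \<forall>y\<in>M. A x y \<longleftrightarrow> rooted.adj M r par x y))" for M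
  have rt: "rooted {r} r (\<lambda>x. x) (\<lambda>x. 0)" by unfold_locales auto
  have g0: "good {r}"
    unfolding good_def using r irr rt by (auto simp: rooted.adj_def[OF rt] intro!: exI[of _ "\<lambda>x. x"] exI[of _ "\<lambda>x. 0"])
  have fg: "finite {M. good M}"
    by (rule finite_subset[of _ "Pow N"]) (auto simp: good_def fin)
  obtain M where M: "good M" and mx: "\<And>M'. good M' \<Longrightarrow> M \<subseteq> M' \<Longrightarrow> M' = M"
    using finite_has_maximal[OF fg] g0 by blast
  obtain par d where R: "rooted M r par d" and MN: "M \<subseteq> N"
    and AM: "\<And>x y. x \<in> M \<Longrightarrow> y \<in> M \<Longrightarrow> A x y \<longleftrightarrow> rooted.adj M r par x y"
    using M unfolding good_def by blast
  interpret R: rooted M r par d by (rule R)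
  have "M = N"
  proof (rule ccontr)
    assume "M \<noteq> N"
    then obtain z where z: "z \<in> N" "z \<notin> M" using MN by auto
    have "(\<lambda>u w. A u w \<and> u \<in> N \<and> w \<in> N)\<^sup>*\<^sup>* r z" using cg r z by (simp add: connected_graph_def)
    then have "z \<in> M \<or> (\<exists>u x. u \<in> M \<and> x \<notin> M \<and> A u x)"
      by (induction rule: rtranclp_induct) (use R.root_in in blast)+
    then obtain u x where ux: "u \<in> M" "x \<notin> M" "A u x" using z by blast
    have only: "w = u" if w: "w \<in> M" "A w x" for w
    proof (rule ccontr)
      assume wu: "w \<noteq> u"
      have "connected_graph M R.adj" using R.is_tree_adj by (simp add: is_tree_def)
      then have "(\<lambda>u w. R.adj u w \<and> u \<in> M \<and> w \<in> M)\<^sup>*\<^sup>* u w" using ux w by (simp add: connected_graph_def)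
      from distinct_walk[OF this] obtain xs where xs: "xs \<noteq> []" "distinct xs" "hd xs = u" "last xs = w"
        "successively (\<lambda>u w. R.adj u w \<and> u \<in> M \<and> w \<in> M) xs" by blast
      have st: "\<And>i. Suc i < length xs \<Longrightarrow> R.adj (xs ! i) (xs ! Suc i) \<and> xs ! i \<in> M \<and> xs ! Suc i \<in> M"
        using xs(5) by (simp add: successively_conv_nth)
      \<comment> \<open>The case rule separates lists of length 0, 1 and more; two vertices make
        \<open>x # xs\<close> long enough for a cycle.\<close>
      have len: "length xs \<ge> 2" using xs wu by (cases xs rule: remdups_adj.cases) auto
      have inM: "set xs \<subseteq> M"
      proof
        fix y assume "y \<in> set xs"
        then obtain i where i: "i < length xs" "y = xs ! i" by (metis in_set_conv_nth)
        show "y \<in> M"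
        proof (cases i)
          case 0
          then show ?thesis using i st[of 0] len by auto
        next
          case (Suc j)
          then show ?thesis using i st[of j] by auto
        qed
      qed
      have "is_cycle N A (x # xs)"
        unfolding is_cycle_def
      proof (intro conjI allI impI)
        fix i assume i: "Suc i < length (x # xs)"
        show "A ((x # xs) ! i) ((x # xs) ! Suc i)"
        proof (cases i)
          case 0
          then show ?thesis using sym[OF ux(3)] xs by (simp add: hd_conv_nth)
        next
          case (Suc j)
          then show ?thesis using st[of j] AM i by auto
        qed
      qed (use len xs inM MN ux w AN[OF ux(3)] in auto)
      then show False using ac by blast
    qed
    let ?par = "par(x := u)" and ?d = "d(x := Suc (d u))"
    have xr: "x \<noteq> r" using ux R.root_in by auto
    interpret R': rooted "insert x M" r ?par ?d
    proof unfold_locales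
      fix y assume y: "y \<in> insert x M" "y \<noteq> r"
      show "?par y \<in> insert x M" using y ux R.par_in by auto
      show "?d (?par y) < ?d y" using y ux R.d_par[of y] R.par_in[of y] by auto
    qed (use R.finite_N R.root_in in auto)
    have "A a b \<longleftrightarrow> R'.adj a b" if "a \<in> insert x M" "b \<in> insert x M" for a b
    proof (cases "a = x"; cases "b = x")
      assume "a = x" "b = x"
      then show ?thesis using irr ux by (auto simp: R'.adj_def)
    next
      assume a: "a = x" "b \<noteq> x"
      then have "A a b \<longleftrightarrow> b = u" using that ux only sym by blast
      moreover have "par b \<noteq> x" if "b \<noteq> r" using R.par_in[of b] that ux \<open>b \<in> insert x M\<close> a by auto
      ultimately show ?thesis using a that ux xr by (auto simp: R'.adj_def)
    next
      assume a: "a \<noteq> x" "b = x"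
      then have "A a b \<longleftrightarrow> a = u" using that ux only sym by blast
      moreover have "par a \<noteq> x" if "a \<noteq> r" using R.par_in[of a] that ux \<open>a \<in> insert x M\<close> a by auto
      ultimately show ?thesis using a that ux xr by (auto simp: R'.adj_def)
    next
      assume a: "a \<noteq> x" "b \<noteq> x"
      then show ?thesis using that AM by (auto simp: R'.adj_def R.adj_def)
    qed
    then have "good (insert x M)"
      unfolding good_def using MN AN[OF ux(3)] R'.rooted_axioms by blast
    then show False using mx ux by blast
  qed
  moreover have "A = R.adj"
    using AM AN \<open>M = N\<close> unfolding fun_eq_iff by (metis R.adj_def)
  ultimately show ?thesis using R by blast
qed


section \<open>Path representations\<close>

text \<open>Path degree 2 and threshold 1 are built in, while the host degree stays free and is
  bounded separately, so that surgery on the host tree can be treated first.\<close>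

definition path_rep where
  "path_rep V E N A Tv \<longleftrightarrow> is_tree N A
     \<and> (\<forall>v\<in>V. is_subtree N A (Tv v) \<and> (\<forall>x\<in>Tv v. deg_in (Tv v) A x \<le> 2))
     \<and> (\<forall>v\<in>V. \<forall>w\<in>V. v \<noteq> w \<longrightarrow> (E v w \<longleftrightarrow> Tv v \<inter> Tv w \<noteq> {}))"

definition bag :: "'a set \<Rightarrow> ('a \<Rightarrow> 'b set) \<Rightarrow> 'b \<Rightarrow> 'a set" where
  "bag V Tv q = {v \<in> V. q \<in> Tv v}"

lemma path_rep_adj:
  "path_rep V E N A Tv \<Longrightarrow> v \<in> V \<Longrightarrow> w \<in> V \<Longrightarrow> v \<noteq> w \<Longrightarrow> E v w \<longleftrightarrow> Tv v \<inter> Tv w \<noteq> {}"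
  by (simp add: path_rep_def)

lemma path_rep_graph:
  assumes "path_rep V E N A Tv"
  shows "finite N" "N \<noteq> {}" "A x y \<Longrightarrow> x \<in> N" "A x y \<Longrightarrow> y \<in> N"
  using assms by (auto simp: path_rep_def is_tree_def simple_graph_def connected_graph_def)

lemma hst_rep_iff_path_rep:
  "hst_rep h 2 1 V E N A Tv \<longleftrightarrow> path_rep V E N A Tv \<and> (\<forall>x\<in>N. enat (deg_in N A x) \<le> h)"
proof (cases "is_tree N A \<and> (\<forall>v\<in>V. is_subtree N A (Tv v))")
  case True
  have two: "enat n \<le> 2 \<longleftrightarrow> n \<le> 2" for n by (simp add: numeral_eq_enat)
  have meet: "Suc 0 \<le> card (Tv v \<inter> Tv w) \<longleftrightarrow> Tv v \<inter> Tv w \<noteq> {}" if "v \<in> V" for v w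
  proof -
    have "finite N" "Tv v \<subseteq> N" using that True by (auto simp: is_tree_def simple_graph_def is_subtree_def)
    then have "finite (Tv v \<inter> Tv w)" using finite_subset by blast
    then show ?thesis by (simp add: Suc_le_eq card_gt_0_iff)
  qed
  show ?thesis
    unfolding hst_rep_def path_rep_def using True by (simp add: two meet cong: ball_cong) blast
next
  case False
  then show ?thesis unfolding hst_rep_def path_rep_def by blast
qed

text \<open>The root is at choice, and most proofs below put it at the host vertex under
  study.\<close>

lemma path_rep_rooted:
  assumes "path_rep V E N A Tv" "r \<in> N"
  obtains par d where "rooted N r par d" "A = rooted.adj N r par"
    "\<And>v. v \<in> V \<Longrightarrow> Tv v \<subseteq> N \<and> (\<exists>t. rooted.top r par (Tv v) t)"
proof -
  obtain par d where R: "rooted N r par d" "A = rooted.adj N r par"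
    using tree_rooted[of N A r] assms unfolding path_rep_def by blast
  have "Tv v \<subseteq> N \<and> (\<exists>t. rooted.top r par (Tv v) t)" if "v \<in> V" for v
    using assms(1) that unfolding path_rep_def R(2) rooted.is_subtree_iff[OF R(1)] by simp
  then show ?thesis using that R by blast
qed

text \<open>The paths of a complete set meet pairwise, so the Helly property gives a common host
  vertex.\<close>

lemma complete_in_bag:
  assumes P: "path_rep V E N A Tv" and D: "complete_set V E D" "finite D" "D \<noteq> {}"
  shows "\<exists>q\<in>N. D \<subseteq> bag V Tv q"
proof -
  obtain r where "r \<in> N" using path_rep_graph(2)[OF P] by blast
  from path_rep_rooted[OF P this] obtain par d where R: "rooted N r par d" and A: "A = rooted.adj N r par"
    and sub: "\<And>v. v \<in> V \<Longrightarrow> Tv v \<subseteq> N \<and> (\<exists>t. rooted.top r par (Tv v) t)" by blast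
  interpret rooted N r par d by (rule R)
  have DV: "D \<subseteq> V" using D by (simp add: complete_set_def)
  have "\<exists>z. \<forall>S\<in>Tv ` D. z \<in> S"
  proof (rule helly)
    fix S S' assume "S \<in> Tv ` D" "S' \<in> Tv ` D"
    then obtain v w where vw: "v \<in> D" "w \<in> D" "S = Tv v" "S' = Tv w" by auto
    have "S \<noteq> {}" using sub[of v] vw DV by (auto simp: top_def)
    moreover have "v \<noteq> w \<Longrightarrow> S \<inter> S' \<noteq> {}"
      using vw D(1) DV path_rep_adj[OF P, of v w] unfolding complete_set_def by blast
    ultimately show "S \<inter> S' \<noteq> {}" using vw by auto
  next
    fix S assume "S \<in> Tv ` D"
    then show "S \<subseteq> N \<and> (\<exists>t. top S t)" using sub DV by blast
  qed (use D in simp_all)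
  then obtain z where z: "\<And>v. v \<in> D \<Longrightarrow> z \<in> Tv v" by auto
  obtain v where "v \<in> D" using D(3) by blast
  then have "z \<in> N" using z DV sub by blast
  then show ?thesis using z DV by (auto simp: bag_def)
qed

lemma bag_complete:
  assumes "path_rep V E N A Tv"
  shows "complete_set V E (bag V Tv q)"
  using path_rep_adj[OF assms] by (auto simp: complete_set_def bag_def)

section \<open>Necessity of the colouring condition\<close>

lemma colorable_of_rep:
  assumes "finite V" and P: "path_rep V E N A Tv" and deg: "\<And>x. x \<in> N \<Longrightarrow> deg_in N A x \<le> h"
    and sym: "\<And>x y. E x y \<Longrightarrow> E y x" and C: "clique V E C"
  shows "colorable (branch_vertices V E C) (branch_adj V E C) h"
proof (cases "C = {}")
  case True
  then show ?thesis by (simp add: colorable_def branch_vertices_def)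
next
  case False
  have CV: "C \<subseteq> V" using C by (simp add: clique_def complete_set_def)
  obtain q where q: "q \<in> N" "C \<subseteq> bag V Tv q"
    using complete_in_bag[OF P _ _ False] C CV assms(1) finite_subset by (auto simp: clique_def)
  have Cq: "C = bag V Tv q" using bag_complete[OF P, of q] C q by (metis clique_def)
  from path_rep_rooted[OF P q(1)] obtain par d where R: "rooted N q par d" and A: "A = rooted.adj N q par"
    and sub: "\<And>v. v \<in> V \<Longrightarrow> Tv v \<subseteq> N \<and> (\<exists>t. rooted.top q par (Tv v) t)" by blast
  interpret rooted N q par d by (rule R)
  obtain tp where tp: "\<And>v. v \<in> V \<Longrightarrow> top (Tv v) (tp v)" using sub by metis
  have E: "E v w \<longleftrightarrow> Tv v \<inter> Tv w \<noteq> {}" if "v \<in> V" "w \<in> V" "v \<noteq> w" for v w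
    using path_rep_adj[OF P that] .
  let ?B = "branch_vertices V E C"
  have B: "v \<in> V" "v \<notin> C" "tp v \<noteq> q" "tp v \<in> N" if "v \<in> ?B" for v
    using that Cq tp[of v] sub[of v] by (auto simp: branch_vertices_def bag_def top_def)
  \<comment> \<open>The child \<open>b v\<close> of \<open>q\<close> above the path of
    \<open>v\<close> is the colour, up to the numbering \<open>g\<close> below.\<close>
  have "\<forall>v\<in>?B. \<exists>b. adj q b \<and> b \<noteq> q \<and> pr\<^sup>*\<^sup>* b (tp v)" using child_above B by blast
  then obtain b where b: "\<And>v. v \<in> ?B \<Longrightarrow> adj q (b v) \<and> b v \<noteq> q \<and> pr\<^sup>*\<^sup>* (b v) (tp v)" by metis
  have ctop: "top (Tv c) q" if "c \<in> C" for c
    using that Cq tp[of c] sub[of c] top_root by (auto simp: bag_def)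
  \<comment> \<open>A path through \<open>q\<close> that meets the path of \<open>v\<close> comes
    down from \<open>q\<close> and must enter it at its top.\<close>
  have hit: "tp v \<in> Tv c" if v: "v \<in> ?B" and c: "c \<in> C" "E c v" for v c
  proof -
    have "c \<noteq> v" "c \<in> V" using v c B CV by auto
    then obtain z where z: "z \<in> Tv c" "z \<in> Tv v" using E[of c v] v c B(1)[OF v] by blast
    have "pr\<^sup>*\<^sup>* (tp v) z" using top_anc sub tp B(1)[OF v] z by blast
    then show ?thesis using anc_in[OF ctop[OF c(1)]] z anc_le root_anc B(4)[OF v] by blast
  qed
  \<comment> \<open>If the top of \<open>v\<close> is an ancestor of the top of \<open>w\<close>,
    every member of \<open>C\<close> adjacent to \<open>w\<close> passes the top of \<open>v\<close>
    on its way down, so condition (3) of the branch graph fails.\<close>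
  have dominated: "E c v" if vw: "v \<in> ?B" "w \<in> ?B" "c \<in> C" "E c w" "pr\<^sup>*\<^sup>* (tp v) (tp w)" for v w c
  proof -
    have "d q \<le> d (tp v)" using anc_le[OF root_anc[OF B(4)[OF vw(1)]]] .
    then have "tp v \<in> Tv c" using anc_in[OF ctop[OF vw(3)] vw(5) hit[OF vw(2-4)]] by blast
    moreover have "tp v \<in> Tv v" using tp[OF B(1)[OF vw(1)]] by (simp add: top_def)
    moreover have "c \<in> V" "c \<noteq> v" using vw(3) B(2)[OF vw(1)] CV by auto
    ultimately show ?thesis using E[of c v] B(1)[OF vw(1)] by blast
  qed
  have diff: "b v \<noteq> b w" if a: "branch_adj V E C v w" for v w
  proof
    assume bb: "b v = b w"
    obtain c v' w' where vw: "v \<in> ?B" "w \<in> ?B" and c: "c \<in> C" "E c v" "E c w"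
      and v': "v' \<in> C" "E v' v" "\<not> E v' w" and w': "w' \<in> C" "E w' w" "\<not> E w' v"
      using a unfolding branch_adj_def by blast
    have cV: "c \<in> V" using c CV by auto
    have "pr\<^sup>*\<^sup>* (tp v) (tp w) \<or> pr\<^sup>*\<^sup>* (tp w) (tp v)"
    proof (rule path_below_linear)
      show "Tv c \<subseteq> N" using sub cV by blast
      show "top (Tv c) q" using ctop c by blast
      show "\<And>x. x \<in> Tv c \<Longrightarrow> deg_in (Tv c) adj x \<le> 2" using P cV A by (auto simp: path_rep_def)
      show "b v \<noteq> q" "pr\<^sup>*\<^sup>* (b v) (tp v)" "pr\<^sup>*\<^sup>* (b v) (tp w)" using b[OF vw(1)] b[OF vw(2)] bb by simp_all
      show "tp v \<in> Tv c" "tp w \<in> Tv c" using hit vw c by auto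
    qed
    then show False
      using dominated[OF vw w'(1,2)] dominated[OF vw(2,1) v'(1,2)] v'(3) w'(3) by blast
  qed
  have finQ: "finite {y \<in> N. A q y}" using finite_N by simp
  \<comment> \<open>\<open>g\<close> numbers the neighbours of \<open>q\<close> from 0, and there
    are at most \<open>h\<close> of them.\<close>
  obtain g where g: "inj_on g {y \<in> N. A q y}" "g ` {y \<in> N. A q y} = {0..<deg_in N A q}"
    unfolding deg_in_def using ex_bij_betw_finite_nat[OF finQ] by (auto simp: bij_betw_def)
  have bin: "b v \<in> {y \<in> N. A q y}" if "v \<in> ?B" for v using b[OF that] adj_def[of q "b v"] A by blast
  have "g (b v) < h" if "v \<in> ?B" for v
    using imageI[OF bin[OF that], of g] g(2) deg[OF q(1)] by simp
  moreover have "g (b v) \<noteq> g (b w)" if "v \<in> ?B" "w \<in> ?B" "branch_adj V E C v w" for v w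
    using diff[OF that(3)] inj_onD[OF g(1) _ bin[OF that(1)] bin[OF that(2)]] by blast
  ultimately show ?thesis unfolding colorable_def by (intro exI[of _ "\<lambda>v. g (b v)"]) auto
qed


section \<open>Contracting an edge\<close>

text \<open>Controls a degree when the neighbour \<open>a\<close> gives way to a new neighbour
  \<open>y\<close>.\<close>

lemma card_swap_le:
  assumes "finite B" "a \<in> B" "S \<subseteq> insert y (B - {a})"
  shows "card S \<le> card B"
proof -
  have "card S \<le> card (insert y (B - {a}))" using assms by (intro card_mono) auto
  also have "\<dots> \<le> Suc (card (B - {a}))" using assms by (intro card_insert_le_m1) auto
  also have "\<dots> = card B" using assms by (metis card.remove finite_Diff)
  finally show ?thesis .
qed

text \<open>Rooted at \<open>q\<close>, the contraction deletes \<open>p\<close> and hands its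
  children to \<open>q\<close>. The bag inclusion puts \<open>q\<close> on every path through
  \<open>p\<close>, so paths stay connected and every intersection that contained \<open>p\<close>
  still contains \<open>q\<close>.\<close>

lemma contract_edge:
  assumes P: "path_rep V E N A Tv" and pq: "A p q" and bags: "bag V Tv p \<subseteq> bag V Tv q"
  shows "\<exists>A' Tv'. path_rep V E (N - {p}) A' Tv'"
proof -
  have "q \<in> N" using path_rep_graph(4)[OF P pq] .
  from path_rep_rooted[OF P this] obtain par d where R: "rooted N q par d" and A: "A = rooted.adj N q par"
    and sub: "\<And>v. v \<in> V \<Longrightarrow> Tv v \<subseteq> N \<and> (\<exists>t. rooted.top q par (Tv v) t)" by blast
  interpret rooted N q par d by (rule R)
  have p: "p \<in> N" "p \<noteq> q" "par p = q"
    using pq d_par[of p] A by (auto simp: adj_def)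
  let ?par = "\<lambda>x. if par x = p then q else par x"
  interpret R': rooted "N - {p}" q ?par d
  proof unfold_locales
    fix x assume x: "x \<in> N - {p}" "x \<noteq> q"
    show "?par x \<in> N - {p}" using x par_in[of x] p root_in by auto
    show "d (?par x) < d x" using x d_par[of x] d_par[of p] p by auto
  qed (use finite_N root_in p in auto)
  let ?Tv = "\<lambda>v. Tv v - {p}"
  have q_of_p: "q \<in> Tv v" if "v \<in> V" "p \<in> Tv v" for v using bags that by (auto simp: bag_def)
  have "path_rep V E (N - {p}) R'.adj ?Tv"
    unfolding path_rep_def
  proof (intro conjI ballI impI)
    show "is_tree (N - {p}) R'.adj" by (rule R'.is_tree_adj)
  next
    fix v assume v: "v \<in> V"
    obtain t where t: "top (Tv v) t" using sub v by blast
    have tp: "t \<noteq> p" using top_root[OF _ t q_of_p[OF v]] sub[OF v] t p(2) by (auto simp: top_def)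
    have "?par x \<in> ?Tv v" if "x \<in> ?Tv v" "x \<noteq> t" for x
      using that t q_of_p[OF v] p(2) by (auto simp: top_def)
    then have "R'.top (?Tv v) t"
      using t tp by (simp add: R'.top_def top_def)
    then show "is_subtree (N - {p}) R'.adj (?Tv v)" unfolding R'.is_subtree_iff using sub v by blast
    fix x assume x: "x \<in> ?Tv v"
    let ?D = "{y \<in> ?Tv v. R'.adj x y}" and ?B = "\<lambda>x. {y \<in> Tv v. adj x y}"
    have deg: "card (?B z) \<le> 2" if "z \<in> Tv v" for z
      using P v that A by (auto simp: path_rep_def deg_in_def)
    have finv: "finite (Tv v)" using sub v finite_N finite_subset by blast
    \<comment> \<open>A path through \<open>q\<close> but not \<open>p\<close> contains no child of
      \<open>p\<close>, so it gains no edge at \<open>q\<close>.\<close>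
    have nopar: "par y \<noteq> p" if "y \<in> Tv v" "y \<noteq> q" "q \<in> Tv v" "p \<notin> Tv v" for y
    proof -
      have "t = q" using top_root[OF _ t that(3)] sub v by blast
      then show ?thesis using that t by (auto simp: top_def)
    qed
    show "deg_in (?Tv v) R'.adj x \<le> 2"
    proof (cases "x = q")
      case True
      show ?thesis
      proof (cases "p \<in> Tv v")
        case True
        \<comment> \<open>At \<open>q\<close> the neighbour \<open>p\<close> is replaced by what
          lies beyond \<open>p\<close>; each of the two sides contributes at most one
          vertex.\<close>
        have "?D \<subseteq> (?B q - {p}) \<union> (?B p - {q})"
          using \<open>x = q\<close> p root_in by (auto simp: R'.adj_def adj_def split: if_splits)
        moreover have "card (?B q - {p}) \<le> 1"
          using deg[of q] q_of_p[OF v True] True p root_in finv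
          by (subst card_Diff_singleton) (auto simp: adj_def)
        moreover have "card (?B p - {q}) \<le> 1"
          using deg[of p] q_of_p[OF v True] True p root_in finv
          by (subst card_Diff_singleton) (auto simp: adj_def)
        ultimately have "card ?D \<le> 1 + 1" using finv
            card_mono[of "(?B q - {p}) \<union> (?B p - {q})" ?D] card_Un_le[of "?B q - {p}" "?B p - {q}"] by simp
        then show ?thesis by (simp add: deg_in_def)
      next
        case False
        have "?D \<subseteq> ?B q" using True x False nopar by (auto simp: R'.adj_def adj_def)
        then have "card ?D \<le> card (?B q)" using finv by (intro card_mono) auto
        then show ?thesis using deg[of q] True x by (simp add: deg_in_def)
      qed
    next
      case False
      show ?thesis
      proof (cases "par x = p \<and> p \<in> Tv v")
        case True
        \<comment> \<open>The child \<open>x\<close> of \<open>p\<close> has its neighbour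
          \<open>p\<close> replaced by \<open>q\<close>.\<close>
        have "?D \<subseteq> insert q (?B x - {p})" using False True by (auto simp: R'.adj_def adj_def split: if_splits)
        moreover have "p \<in> ?B x" using True False x sub v p by (auto simp: adj_def)
        ultimately have "card ?D \<le> card (?B x)" using finv by (intro card_swap_le) auto
        then show ?thesis using deg[of x] x by (simp add: deg_in_def)
      next
        case F: False
        have "?D \<subseteq> ?B x" using False F x nopar by (auto simp: R'.adj_def adj_def split: if_splits)
        then have "card ?D \<le> card (?B x)" using finv by (intro card_mono) auto
        then show ?thesis using deg[of x] x by (simp add: deg_in_def)
      qed
    qed
  next
    fix v w assume vw: "v \<in> V" "w \<in> V" "v \<noteq> w"
    have "E v w \<longleftrightarrow> Tv v \<inter> Tv w \<noteq> {}" using path_rep_adj[OF P vw] by blast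
    also have "\<dots> \<longleftrightarrow> ?Tv v \<inter> ?Tv w \<noteq> {}"
      using q_of_p[OF vw(1)] q_of_p[OF vw(2)] p(2) by auto
    finally show "E v w \<longleftrightarrow> ?Tv v \<inter> ?Tv w \<noteq> {}" .
  qed
  then show ?thesis by blast
qed

text \<open>Every contraction removes a host vertex, so the process stops.\<close>

lemma minimal_path_rep:
  assumes "path_rep V E N A Tv"
  shows "\<exists>N' A' Tv'. N' \<subseteq> N \<and> path_rep V E N' A' Tv' \<and> (\<forall>p q. A' p q \<longrightarrow> \<not> bag V Tv' p \<subseteq> bag V Tv' q)"
  using assms
proof (induction "card N" arbitrary: N A Tv rule: less_induct)
  case less
  show ?case
  proof (cases "\<exists>p q. A p q \<and> bag V Tv p \<subseteq> bag V Tv q")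
    case True
    then obtain p q where pq: "A p q" "bag V Tv p \<subseteq> bag V Tv q" by blast
    have "p \<in> N" "finite N" using path_rep_graph[OF less.prems] pq by blast+
    then have "card (N - {p}) < card N" by (metis card_Diff1_less)
    moreover obtain A' Tv' where "path_rep V E (N - {p}) A' Tv'" using contract_edge[OF less.prems pq] by blast
    ultimately have "\<exists>N' A' Tv'. N' \<subseteq> N - {p} \<and> path_rep V E N' A' Tv' \<and>
        (\<forall>p q. A' p q \<longrightarrow> \<not> bag V Tv' p \<subseteq> bag V Tv' q)"
      by (rule less.hyps)
    then show ?thesis by blast
  next
    case False
    then show ?thesis using less.prems by (intro exI[of _ N] exI[of _ A] exI[of _ Tv]) blast
  qed
qed

section \<open>Colouring the neighbours of a host vertex\<close>

text \<open>This is a proper \<open>h\<close>-colouring of the graph on the neighbours of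
  \<open>q\<close> in which two are joined when some path contains both and
  \<open>q\<close>.\<close>

definition branch_coloring where
  "branch_coloring V A Tv h q f \<longleftrightarrow> (\<forall>x. A q x \<longrightarrow> f x < (h::nat)) \<and>
     (\<forall>x x'. A q x \<and> A q x' \<and> x \<noteq> x' \<and> f x = f x' \<longrightarrow> bag V Tv q \<inter> bag V Tv x \<inter> bag V Tv x' = {})"

text \<open>A strictly larger complete set lies in the bag of some other \<open>r\<close>. Every
  path through \<open>q\<close> then runs on to \<open>r\<close> and contains the next vertex
  towards \<open>r\<close>, whose bag therefore includes that of \<open>q\<close>.\<close>

lemma bag_clique:
  assumes fin: "finite V" and P: "path_rep V E N A Tv" and q: "q \<in> N"
    and red: "\<And>p q. A p q \<Longrightarrow> \<not> bag V Tv p \<subseteq> bag V Tv q"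
  shows "clique V E (bag V Tv q)"
  unfolding clique_def
proof (intro conjI allI impI)
  show "complete_set V E (bag V Tv q)" by (rule bag_complete[OF P])
  fix D assume D: "complete_set V E D \<and> bag V Tv q \<subseteq> D"
  show "D = bag V Tv q"
  proof (rule ccontr)
    assume ne: "D \<noteq> bag V Tv q"
    then have "D \<noteq> {}" using D by auto
    moreover have "finite D" using D fin finite_subset by (auto simp: complete_set_def)
    ultimately obtain r where r: "r \<in> N" "D \<subseteq> bag V Tv r" using complete_in_bag[OF P] D by blast
    from path_rep_rooted[OF P r(1)] obtain par d where R: "rooted N r par d" and A: "A = rooted.adj N r par"
      and sub: "\<And>v. v \<in> V \<Longrightarrow> Tv v \<subseteq> N \<and> (\<exists>t. rooted.top r par (Tv v) t)" by blast
    interpret rooted N r par d by (rule R)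
    have "q \<noteq> r" using D r ne by auto
    then have "A q (par q)" using A q par_in by (simp add: adj_def)
    moreover have "bag V Tv q \<subseteq> bag V Tv (par q)"
    proof
      fix c assume c: "c \<in> bag V Tv q"
      then have "c \<in> bag V Tv r" using D r by blast
      then have cV: "c \<in> V" "q \<in> Tv c" "r \<in> Tv c" using c by (auto simp: bag_def)
      obtain t where t: "top (Tv c) t" using sub[OF cV(1)] by blast
      have "t = r" using top_root[OF _ t cV(3)] sub[OF cV(1)] by blast
      then show "c \<in> bag V Tv (par q)" using t cV \<open>q \<noteq> r\<close> by (auto simp: top_def bag_def)
    qed
    ultimately show False using red by blast
  qed
qed

text \<open>With two colours available, a vertex with at most one neighbour can be coloured after
  all others. Peeling off such vertices leaves a subset in which every vertex has two neighbours,
  and there \<open>core\<close> supplies the colouring.\<close>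

lemma greedy_coloring:
  fixes I :: "'b \<Rightarrow> 'b \<Rightarrow> bool"
  assumes "finite J" and sym: "\<And>x y. I x y \<Longrightarrow> I y x" and h: "2 \<le> (h::nat)"
    and core: "\<And>K. K \<subseteq> J \<Longrightarrow>
        (\<And>x. x \<in> K \<Longrightarrow> \<exists>y\<in>K. \<exists>z\<in>K. y \<noteq> x \<and> z \<noteq> x \<and> y \<noteq> z \<and> I x y \<and> I x z) \<Longrightarrow>
        \<exists>f. (\<forall>x\<in>K. f x < h) \<and> (\<forall>x\<in>K. \<forall>y\<in>K. x \<noteq> y \<and> I x y \<longrightarrow> f x \<noteq> f y)"
  shows "\<exists>f. (\<forall>x\<in>J. f x < h) \<and> (\<forall>x\<in>J. \<forall>y\<in>J. x \<noteq> y \<and> I x y \<longrightarrow> f x \<noteq> f y)"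
  using assms(1) core
proof (induction J rule: finite_psubset_induct)
  case (psubset J)
  show ?case
  proof (cases "\<forall>x\<in>J. \<exists>y\<in>J. \<exists>z\<in>J. y \<noteq> x \<and> z \<noteq> x \<and> y \<noteq> z \<and> I x y \<and> I x z")
    case True
    then show ?thesis using psubset.prems[of J] by blast
  next
    case False
    then obtain x where x: "x \<in> J"
      and one: "\<And>y z. y \<in> J \<Longrightarrow> z \<in> J \<Longrightarrow> y \<noteq> x \<Longrightarrow> z \<noteq> x \<Longrightarrow> I x y \<Longrightarrow> I x z \<Longrightarrow> y = z" by blast
    have "\<exists>f. (\<forall>x\<in>J - {x}. f x < h) \<and> (\<forall>u\<in>J - {x}. \<forall>y\<in>J - {x}. u \<noteq> y \<and> I u y \<longrightarrow> f u \<noteq> f y)"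
    proof (rule psubset.IH)
      show "J - {x} \<subset> J" using x by auto
      fix K assume "K \<subseteq> J - {x}"
        and K: "\<And>x. x \<in> K \<Longrightarrow> \<exists>y\<in>K. \<exists>z\<in>K. y \<noteq> x \<and> z \<noteq> x \<and> y \<noteq> z \<and> I x y \<and> I x z"
      then have "K \<subseteq> J" by auto
      from psubset.prems[OF this K]
      show "\<exists>f. (\<forall>x\<in>K. f x < h) \<and> (\<forall>x\<in>K. \<forall>y\<in>K. x \<noteq> y \<and> I x y \<longrightarrow> f x \<noteq> f y)" by blast
    qed
    then obtain f where f: "\<And>u. u \<in> J - {x} \<Longrightarrow> f u < h"
      "\<And>u y. u \<in> J - {x} \<Longrightarrow> y \<in> J - {x} \<Longrightarrow> u \<noteq> y \<Longrightarrow> I u y \<Longrightarrow> f u \<noteq> f y" by blast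
    obtain k where k: "k < h" "\<And>y. y \<in> J \<Longrightarrow> y \<noteq> x \<Longrightarrow> I x y \<Longrightarrow> f y \<noteq> k"
    proof (cases "\<exists>y\<in>J. y \<noteq> x \<and> I x y")
      case True
      then obtain y where y: "y \<in> J" "y \<noteq> x" "I x y" by blast
      \<comment> \<open>The only neighbour already coloured blocks one colour, so 0 or 1
        remains.\<close>
      let ?k = "if f y = 0 then 1 else 0 :: nat"
      show ?thesis
      proof (rule that[of ?k])
        fix z assume "z \<in> J" "z \<noteq> x" "I x z"
        then have "z = y" using one y by blast
        then show "f z \<noteq> ?k" by simp
      qed (use h in simp)
    next
      case False
      then show ?thesis using that[of 0] h by auto
    qed
    show ?thesis
      by (rule exI[of _ "f(x := k)"]) (use f k sym in auto)
  qed
qed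

text \<open>If the paths through \<open>q\<close> and \<open>x\<close> all pass through \<open>x'\<close>, then no path through \<open>q\<close> and \<open>x\<close>
  meets a third neighbour of \<open>q\<close>. So in a subfamily where each neighbour shares paths with two others,
  sharing a path forces the branch vertices chosen at \<open>x\<close> and \<open>x'\<close> to be adjacent in the branch graph.\<close>

lemma branch_coloring_exists:
  assumes fin: "finite V" and P: "path_rep V E N A Tv" and q: "q \<in> N"
    and sym: "\<And>x y. E x y \<Longrightarrow> E y x"
    and red: "\<And>p q. A p q \<Longrightarrow> \<not> bag V Tv p \<subseteq> bag V Tv q"
    and h: "2 \<le> h"
    and col: "\<And>C. clique V E C \<Longrightarrow> colorable (branch_vertices V E C) (branch_adj V E C) h"
  shows "\<exists>f. branch_coloring V A Tv h q f"
proof -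
  let ?C = "bag V Tv q"
  let ?B = "branch_vertices V E ?C"
  obtain g where g: "\<And>v. v \<in> ?B \<Longrightarrow> g v < h"
    "\<And>v w. v \<in> ?B \<Longrightarrow> w \<in> ?B \<Longrightarrow> branch_adj V E ?C v w \<Longrightarrow> g v \<noteq> g w"
    using col[OF bag_clique[OF fin P q red]] unfolding colorable_def by blast
  from path_rep_rooted[OF P q] obtain par d where R: "rooted N q par d" and A: "A = rooted.adj N q par"
    and sub: "\<And>v. v \<in> V \<Longrightarrow> Tv v \<subseteq> N \<and> (\<exists>t. rooted.top q par (Tv v) t)" by blast
  interpret rooted N q par d by (rule R)
  have E: "E v w \<longleftrightarrow> Tv v \<inter> Tv w \<noteq> {}" if "v \<in> V" "w \<in> V" "v \<noteq> w" for v w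
    using path_rep_adj[OF P that] .
  have child: "x \<in> N" "x \<noteq> q" "par x = q" if "A q x" for x
    using that A d_par[of x] by (auto simp: adj_def)
  \<comment> \<open>The absence of bag inclusions gives each neighbour \<open>x\<close> of
    \<open>q\<close> a path through \<open>x\<close> that misses \<open>q\<close>. This
    representative will carry the colouring of the branch graph over to \<open>x\<close>.\<close>
  have "\<forall>x. A q x \<longrightarrow> (\<exists>v. v \<in> bag V Tv x \<and> v \<notin> ?C)"
    using red A adj_sym by blast
  then obtain rv where rv: "\<And>x. A q x \<Longrightarrow> rv x \<in> bag V Tv x \<and> rv x \<notin> ?C" by metis
  have rvV: "rv x \<in> V" "x \<in> Tv (rv x)" "q \<notin> Tv (rv x)" if "A q x" for x
    using rv[OF that] by (auto simp: bag_def)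
  have rtop: "top (Tv (rv x)) x" if x: "A q x" for x
  proof -
    obtain t where "top (Tv (rv x)) t" using sub rvV[OF x] by blast
    moreover from this have "t = x" using rvV[OF x] child[OF x] by (auto simp: top_def)
    ultimately show ?thesis by simp
  qed
  have ctop: "top (Tv c) q" if "c \<in> ?C" for c
    using that sub[of c] top_root by (auto simp: bag_def)
  \<comment> \<open>Seen from \<open>q\<close>, the path of \<open>rv x\<close> hangs entirely below
    \<open>x\<close>, so a path through \<open>q\<close> meets it only by passing
    \<open>x\<close>.\<close>
  have meet: "E c (rv x) \<longleftrightarrow> x \<in> Tv c" if c: "c \<in> ?C" and x: "A q x" for c x
  proof -
    have "c \<in> V" "c \<noteq> rv x" using c rv[OF x] by (auto simp: bag_def)
    then have "E c (rv x) \<longleftrightarrow> Tv c \<inter> Tv (rv x) \<noteq> {}" using E rvV x by blast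
    moreover have "x \<in> Tv c" if z: "z \<in> Tv c" "z \<in> Tv (rv x)" for z
    proof -
      have "pr\<^sup>*\<^sup>* x z" using top_anc rtop[OF x] z sub rvV[OF x] by blast
      then show ?thesis using anc_in[OF ctop[OF c]] z root_anc anc_le child[OF x] by blast
    qed
    ultimately show ?thesis using rvV[OF x] by blast
  qed
  have apart: "\<not> E (rv x) (rv x')" "rv x \<noteq> rv x'" if x: "A q x" "A q x'" "x \<noteq> x'" for x x'
  proof -
    \<comment> \<open>A common vertex would put the top of no smaller rank on the other path, and
      with it that top's parent \<open>q\<close>.\<close>
    have disj: False if xx: "A q x" "A q x'" "x \<noteq> x'" "d x' \<le> d x"
      and z: "z \<in> Tv (rv x)" "z \<in> Tv (rv x')" for x x' z
    proof -
      have "pr\<^sup>*\<^sup>* x z" using top_anc rtop xx z sub rvV by blast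
      then have "x \<in> Tv (rv x')" using anc_in[OF rtop[OF xx(2)]] z xx by blast
      then show False using rtop[OF xx(2)] xx child rvV by (metis top_def)
    qed
    have "Tv (rv x) \<inter> Tv (rv x') = {}"
      using disj[of x x'] disj[of x' x] x by (metis disjoint_iff nat_le_linear)
    moreover from this show "rv x \<noteq> rv x'" using rvV[OF x(1)] by auto
    ultimately show "\<not> E (rv x) (rv x')" using E rvV x by blast
  qed
  let ?I = "\<lambda>x x'. ?C \<inter> bag V Tv x \<inter> bag V Tv x' \<noteq> {}"
  have "\<exists>f. (\<forall>x\<in>{x. A q x}. f x < h) \<and>
      (\<forall>x\<in>{x. A q x}. \<forall>y\<in>{x. A q x}. x \<noteq> y \<and> ?I x y \<longrightarrow> f x \<noteq> f y)"
  proof (rule greedy_coloring)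
    show "finite {x. A q x}" by (rule finite_subset[OF _ finite_N]) (use child in auto)
    show "2 \<le> h" by (rule h)
    show "\<And>x y. ?I x y \<Longrightarrow> ?I y x" by blast
    fix K assume K: "K \<subseteq> {x. A q x}"
      and two: "\<And>x. x \<in> K \<Longrightarrow> \<exists>y\<in>K. \<exists>z\<in>K. y \<noteq> x \<and> z \<noteq> x \<and> y \<noteq> z \<and> ?I x y \<and> ?I x z"
    \<comment> \<open>A path shared with another neighbour is a member of the clique adjacent to
      \<open>rv x\<close>.\<close>
    have inB: "rv x \<in> ?B" if x: "x \<in> K" for x
    proof -
      obtain c where c: "c \<in> ?C" "c \<in> bag V Tv x" using two[OF x] by blast
      have "A q x" using x K by blast
      then have "E c (rv x)" using meet c by (simp add: bag_def)
      then show ?thesis using sym rv rvV c \<open>A q x\<close> by (auto simp: branch_vertices_def)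
    qed
    have incomp: "\<exists>c\<in>?C. x \<in> Tv c \<and> x' \<notin> Tv c" if x: "x \<in> K" "x' \<in> K" "x \<noteq> x'" for x x'
    proof (rule ccontr)
      assume "\<not> ?thesis"
      then have all: "\<And>c. c \<in> ?C \<Longrightarrow> x \<in> Tv c \<Longrightarrow> x' \<in> Tv c" by blast
      obtain z where z: "z \<in> K" "z \<noteq> x" "z \<noteq> x'" "?I x z" using two[OF x(1)] by metis
      then obtain c where c: "c \<in> ?C" "x \<in> Tv c" "z \<in> Tv c" by (auto simp: bag_def)
      then have "x' \<in> Tv c" using all by blast
      then have "{x, x', z} \<subseteq> {y \<in> Tv c. A q y}" using c x z K by auto
      moreover have cV: "c \<in> V" "q \<in> Tv c" using c by (auto simp: bag_def)
      then have "finite (Tv c)" using sub finite_N finite_subset by blast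
      ultimately have "card {x, x', z} \<le> deg_in (Tv c) A q"
        unfolding deg_in_def by (intro card_mono) auto
      moreover have "card {x, x', z} = 3" using x z by auto
      moreover have "deg_in (Tv c) A q \<le> 2" using P cV by (auto simp: path_rep_def)
      ultimately show False by simp
    qed
    have "branch_adj V E ?C (rv x) (rv x')" if x: "x \<in> K" "x' \<in> K" "x \<noteq> x'" and i: "?I x x'" for x x'
    proof -
      have a: "A q x" "A q x'" using x K by auto
      obtain c where "c \<in> ?C" "x \<in> Tv c" "x' \<in> Tv c" using i by (auto simp: bag_def)
      then have 1: "\<exists>c\<in>?C. E c (rv x) \<and> E c (rv x')" using meet a by blast
      obtain v' w' where "v' \<in> ?C" "x \<in> Tv v'" "x' \<notin> Tv v'" "w' \<in> ?C" "x' \<in> Tv w'" "x \<notin> Tv w'"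
        using incomp x by metis
      then have 2: "\<exists>v'\<in>?C. \<exists>w'\<in>?C. E v' (rv x) \<and> \<not> E v' (rv x') \<and> E w' (rv x') \<and> \<not> E w' (rv x)"
        using meet a by blast
      show ?thesis unfolding branch_adj_def using 1 2 inB x apart a by blast
    qed
    then show "\<exists>f. (\<forall>x\<in>K. f x < h) \<and> (\<forall>x\<in>K. \<forall>y\<in>K. x \<noteq> y \<and> ?I x y \<longrightarrow> f x \<noteq> f y)"
      using g inB by (intro exI[of _ "\<lambda>x. g (rv x)"]) blast
  qed
  then show ?thesis unfolding branch_coloring_def by blast
qed

section \<open>Splitting a host vertex\<close>

definition split_adj :: "('b \<Rightarrow> 'b \<Rightarrow> bool) \<Rightarrow> 'b \<Rightarrow> 'b \<Rightarrow> 'b \<Rightarrow> 'b \<Rightarrow> 'b \<Rightarrow> 'b \<Rightarrow> bool" where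
  "split_adj A q x1 x2 y u w \<longleftrightarrow>
     A u w \<and> \<not> (u = q \<and> w \<in> {x1, x2}) \<and> \<not> (w = q \<and> u \<in> {x1, x2})
     \<or> u = y \<and> w \<in> {q, x1, x2} \<or> w = y \<and> u \<in> {q, x1, x2}"

text \<open>A path containing \<open>q\<close> and one of \<open>x1\<close>, \<open>x2\<close> runs
  along a removed edge; the detour through \<open>y\<close> reconnects it.\<close>

definition split_path :: "('a \<Rightarrow> 'b set) \<Rightarrow> 'b \<Rightarrow> 'b \<Rightarrow> 'b \<Rightarrow> 'b \<Rightarrow> 'a \<Rightarrow> 'b set" where
  "split_path Tv q x1 x2 y v =
     (if q \<in> Tv v \<and> (x1 \<in> Tv v \<or> x2 \<in> Tv v) then insert y (Tv v) else Tv v)"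

text \<open>By \<open>disj\<close> no path uses both edges from \<open>q\<close> to
  \<open>x1\<close> and \<open>x2\<close>; such a path would have degree 3 at \<open>y\<close> after
  the split.\<close>

locale split =
  fixes V :: "'a set" and E and N :: "'b set" and A Tv q x1 x2 y
  assumes P: "path_rep V E N A Tv" and q1: "A q x1" and q2: "A q x2" and ne: "x1 \<noteq> x2"
    and disj: "bag V Tv q \<inter> bag V Tv x1 \<inter> bag V Tv x2 = {}" and y: "y \<notin> N"
begin

lemma fin: "finite N" and AN: "A u w \<Longrightarrow> u \<in> N \<and> w \<in> N" and Asym: "A u w \<Longrightarrow> A w u" and irr: "\<not> A u u"
  using P by (auto simp: path_rep_def is_tree_def simple_graph_def)

lemma in_N: "q \<in> N" "x1 \<in> N" "x2 \<in> N" "q \<noteq> x1" "q \<noteq> x2" "y \<noteq> q" "y \<noteq> x1" "y \<noteq> x2" "\<not> A y w" "\<not> A w y"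
  using AN q1 q2 irr y by metis+

abbreviation "A' \<equiv> split_adj A q x1 x2 y"
abbreviation "Tv' \<equiv> split_path Tv q x1 x2 y"

lemma path_sub: "v \<in> V \<Longrightarrow> Tv v \<subseteq> N"
  using P by (auto simp: path_rep_def is_subtree_def)

lemma one_side: "v \<in> V \<Longrightarrow> q \<in> Tv v \<Longrightarrow> x1 \<in> Tv v \<Longrightarrow> x2 \<notin> Tv v"
  using disj by (auto simp: bag_def)

lemma tree_split: "is_tree (insert y N) A' \<and> (\<forall>v\<in>V. is_subtree (insert y N) A' (Tv' v))"
proof -
  from path_rep_rooted[OF P in_N(1)] obtain par d where R: "rooted N q par d" and A: "A = rooted.adj N q par"
    and sub: "\<And>v. v \<in> V \<Longrightarrow> Tv v \<subseteq> N \<and> (\<exists>t. rooted.top q par (Tv v) t)" by blast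
  interpret rooted N q par d by (rule R)
  have "par x = q" if "A q x" for x
    using that A d_par[of x] by (auto simp: adj_def)
  then have par12: "par x1 = q" "par x2 = q" using q1 q2 by blast+
  have pary: "par u \<noteq> y" if "u \<in> N" "u \<noteq> q" for u using par_in that y by blast
  let ?par = "\<lambda>x. if x = x1 \<or> x = x2 then y else if x = y then q else par x"
  \<comment> \<open>Doubling the ranks leaves an odd value for \<open>y\<close> strictly between
    \<open>q\<close> and its children.\<close>
  let ?d = "\<lambda>x. if x = y then 2 * d q + 1 else 2 * d x"
  interpret R': rooted "insert y N" q ?par ?d
  proof unfold_locales
    fix x assume x: "x \<in> insert y N" "x \<noteq> q"
    show "?par x \<in> insert y N" using x par_in[of x] in_N by auto
    show "?d (?par x) < ?d x" using x d_par[of x] d_par[of x1] d_par[of x2] par12 in_N pary[of x] by auto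
  qed (use fin in_N in auto)
  have "A' = R'.adj"
  proof (intro ext)
    fix u w show "A' u w = R'.adj u w"
      unfolding split_adj_def R'.adj_def A adj_def
      using par12 in_N pary[of u] pary[of w] y ne by auto
  qed
  moreover have "\<exists>t. R'.top (Tv' v) t" if v: "v \<in> V" for v
  proof -
    obtain t where t: "top (Tv v) t" using sub v by blast
    have "y \<notin> Tv v" using path_sub v y by blast
    then have "R'.top (Tv' v) t"
      using t in_N par12 unfolding top_def R'.top_def split_path_def by auto
    then show ?thesis by blast
  qed
  moreover have "Tv' v \<subseteq> insert y N" if "v \<in> V" for v
    using path_sub[OF that] by (auto simp: split_path_def)
  ultimately show ?thesis using R'.is_tree_adj R'.is_subtree_iff by simp
qed

lemma path_deg_split:
  assumes v: "v \<in> V" and x: "x \<in> Tv' v"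
  shows "deg_in (Tv' v) A' x \<le> 2"
proof -
  let ?D = "{w \<in> Tv' v. A' x w}" and ?B = "{w \<in> Tv v. A x w}"
  have finv: "finite (Tv v)" using path_sub v fin finite_subset by blast
  have yv: "y \<notin> Tv v" using path_sub v y by blast
  have deg: "card ?B \<le> 2" if "x \<in> Tv v" using P v that by (auto simp: path_rep_def deg_in_def)
  \<comment> \<open>At an old vertex the split either exchanges one neighbour for \<open>y\<close>
    (\<open>x1\<close> or \<open>x2\<close> at \<open>q\<close>, and \<open>q\<close> at
    \<open>x1\<close> or \<open>x2\<close>) or adds none.\<close>
  consider "x = y" | "x \<noteq> y" "\<exists>a\<in>?B. ?D \<subseteq> insert y (?B - {a})" | "x \<noteq> y" "?D \<subseteq> ?B"
  proof (cases "q \<in> Tv v \<and> (x1 \<in> Tv v \<or> x2 \<in> Tv v)")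
    case False
    then have "x \<noteq> y" "?D \<subseteq> ?B"
      using x yv in_N by (auto simp: split_path_def split_adj_def)
    then show ?thesis using that by blast
  next
    case True
    consider "x = y" | "x = q" "x1 \<in> Tv v" | "x = q" "x2 \<in> Tv v" | "x = x1 \<or> x = x2" | "x \<notin> {y, q, x1, x2}"
      using True by blast
    then show ?thesis
    proof cases
      case 2
      then have "?D \<subseteq> insert y (?B - {x1})" "x1 \<in> ?B"
        using q1 in_N by (auto simp: split_path_def split_adj_def split: if_splits)
      then show ?thesis using that 2 in_N by blast
    next
      case 3
      then have "?D \<subseteq> insert y (?B - {x2})" "x2 \<in> ?B"
        using q2 in_N by (auto simp: split_path_def split_adj_def split: if_splits)
      then show ?thesis using that 3 in_N by blast
    next
      case 4
      then have "?D \<subseteq> insert y (?B - {q})" "q \<in> ?B"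
        using q1 q2 Asym in_N True by (auto simp: split_path_def split_adj_def split: if_splits)
      then show ?thesis using that 4 in_N by blast
    next
      case 5
      then have "?D \<subseteq> ?B" using in_N by (auto simp: split_path_def split_adj_def split: if_splits)
      then show ?thesis using that 5 by blast
    qed (use that in blast)
  qed
  then have "card ?D \<le> 2"
  proof cases
    case 1
    then have "q \<in> Tv v" using x yv by (auto simp: split_path_def split: if_splits)
    \<comment> \<open>By \<open>one_side\<close> the path cannot contain both \<open>x1\<close> and
      \<open>x2\<close>.\<close>
    then have "?D \<subseteq> {q, x1} \<or> ?D \<subseteq> {q, x2}"
      using 1 one_side[OF v] in_N by (auto simp: split_path_def split_adj_def split: if_splits)
    then have "card ?D \<le> card {q, x1} \<or> card ?D \<le> card {q, x2}" by (meson card_mono finite.intros)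
    then show ?thesis using in_N by auto
  next
    case 2
    then have "card ?D \<le> card ?B" using finv card_swap_le[of ?B _ ?D y] by auto
    moreover have "x \<in> Tv v" using x 2 by (auto simp: split_path_def split: if_splits)
    ultimately show ?thesis using deg by simp
  next
    case 3
    then have "card ?D \<le> card ?B" using finv by (intro card_mono) auto
    moreover have "x \<in> Tv v" using x 3 by (auto simp: split_path_def split: if_splits)
    ultimately show ?thesis using deg by simp
  qed
  then show ?thesis by (simp add: deg_in_def)
qed

lemma path_rep_split: "path_rep V E (insert y N) A' Tv'"
proof -
  have "E v w \<longleftrightarrow> Tv' v \<inter> Tv' w \<noteq> {}" if vw: "v \<in> V" "w \<in> V" "v \<noteq> w" for v w
  proof -
    have "y \<notin> Tv v" "y \<notin> Tv w" using path_sub vw y by blast+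
    then have "Tv' v \<inter> Tv' w \<noteq> {} \<longleftrightarrow> Tv v \<inter> Tv w \<noteq> {}" by (auto simp: split_path_def)
    then show ?thesis using path_rep_adj[OF P vw] by blast
  qed
  then show ?thesis unfolding path_rep_def using tree_split path_deg_split by blast
qed

lemma deg_split_new: "deg_in (insert y N) A' y \<le> 3"
proof -
  have "{w \<in> insert y N. A' y w} \<subseteq> {q, x1, x2}" using in_N by (auto simp: split_adj_def)
  then have "deg_in (insert y N) A' y \<le> card {q, x1, x2}" unfolding deg_in_def by (intro card_mono) auto
  also have "\<dots> \<le> 3" by (simp add: card_insert_if)
  finally show ?thesis .
qed

text \<open>Two neighbours leave and one arrives; this strict drop drives termination.\<close>

lemma deg_split_center: "deg_in (insert y N) A' q < deg_in N A q"
proof -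
  let ?B = "{w \<in> N. A q w}"
  have "{w \<in> insert y N. A' q w} \<subseteq> insert y (?B - {x1} - {x2})" using in_N by (auto simp: split_adj_def)
  then have "deg_in (insert y N) A' q \<le> card (insert y (?B - {x1} - {x2}))"
    unfolding deg_in_def using fin by (intro card_mono) auto
  also have "\<dots> \<le> Suc (card (?B - {x1} - {x2}))" using fin by (intro card_insert_le_m1) auto
  also have "\<dots> = card (?B - {x1})" using fin q2 in_N ne by (intro card_Suc_Diff1) auto
  also have "\<dots> < card ?B" using fin q1 in_N by (intro card_Diff1_less) auto
  finally show ?thesis by (simp add: deg_in_def)
qed

lemma deg_split_old: "x \<in> N \<Longrightarrow> deg_in (insert y N) A' x \<le> deg_in N A x"
proof -
  assume x: "x \<in> N"
  let ?D = "{w \<in> insert y N. A' x w}" and ?B = "{w \<in> N. A x w}"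
  consider "x = q" | "x = x1 \<or> x = x2" | "x \<notin> {q, x1, x2}" by blast
  then show ?thesis
  proof cases
    case 1
    then show ?thesis using deg_split_center by simp
  next
    case 2
    then have "?D \<subseteq> insert y (?B - {q})" "q \<in> ?B"
      using q1 q2 Asym in_N by (auto simp: split_adj_def)
    then show ?thesis unfolding deg_in_def using fin by (intro card_swap_le) auto
  next
    case 3
    then have "?D \<subseteq> ?B" using x y in_N by (auto simp: split_adj_def)
    then show ?thesis unfolding deg_in_def using fin by (intro card_mono) auto
  qed
qed

lemma bag_split_old: "x \<in> N \<Longrightarrow> bag V Tv' x = bag V Tv x"
  using y by (auto simp: bag_def split_path_def split: if_splits)

lemma bag_split_new: "bag V Tv' y = bag V Tv q \<inter> (bag V Tv x1 \<union> bag V Tv x2)"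
  using y path_sub by (auto simp: bag_def split_path_def split: if_splits)

text \<open>The new vertex inherits the colour of what it replaces: at \<open>q\<close> the common
  colour of \<open>x1\<close> and \<open>x2\<close>, at \<open>x1\<close> or \<open>x2\<close> the
  colour of \<open>q\<close>. A path causing a conflict with \<open>y\<close> would pass through a
  replaced vertex and already conflict before the split.\<close>

lemma coloring_split:
  assumes p: "p \<in> N" and f: "branch_coloring V A Tv h p f"
    and same: "p = q \<Longrightarrow> f x1 = f x2"
  shows "\<exists>f'. branch_coloring V A' Tv' h p f'"
proof -
  let ?f = "f(y := if p = q then f x1 else f q)"
  have A'p: "A' p u \<longleftrightarrow> (if p = q then u = y \<or> A p u \<and> u \<noteq> x1 \<and> u \<noteq> x2
      else if p = x1 \<or> p = x2 then u = y \<or> A p u \<and> u \<noteq> q else A p u)" for u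
    using p y in_N by (auto simp: split_adj_def)
  have lt: "\<And>x. A p x \<Longrightarrow> f x < h"
    and sep: "\<And>x x'. A p x \<Longrightarrow> A p x' \<Longrightarrow> x \<noteq> x' \<Longrightarrow> f x = f x' \<Longrightarrow>
        bag V Tv p \<inter> bag V Tv x \<inter> bag V Tv x' = {}"
    using f unfolding branch_coloring_def by blast+
  have old: "u \<in> N" "u \<noteq> y" if "A p u" for u using AN that y by metis+
  have "?f u < h" if "A' p u" for u
    using that lt q1 q2 Asym old by (auto simp: A'p split: if_splits)
  moreover have new: "bag V Tv p \<inter> bag V Tv u \<inter> bag V Tv' y = {}"
    if u: "A' p u" "A' p y" "u \<noteq> y" "f u = ?f y" for u
  proof -
    have Au: "A p u" using u(1,3) unfolding A'p by (auto split: if_splits)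
    show ?thesis
    proof (cases "p = q")
      case True
      then have "u \<noteq> x1" "u \<noteq> x2" using u(1,3) unfolding A'p by simp_all
      then have "bag V Tv p \<inter> bag V Tv u \<inter> bag V Tv x1 = {}" "bag V Tv p \<inter> bag V Tv u \<inter> bag V Tv x2 = {}"
        using sep[OF Au, of x1] sep[OF Au, of x2] same True u q1 q2 by auto
      then show ?thesis using bag_split_new by blast
    next
      case False
      then have "p = x1 \<or> p = x2" "u \<noteq> q" using u(1-3) in_N unfolding A'p by (auto split: if_splits)
      then have "bag V Tv p \<inter> bag V Tv u \<inter> bag V Tv q = {}"
        using sep[OF Au, of q] False u q1 q2 Asym by auto
      then show ?thesis using bag_split_new by blast
    qed
  qed
  ultimately have "branch_coloring V A' Tv' h p ?f"
    unfolding branch_coloring_def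
  proof (intro conjI allI impI)
    fix u w assume uw: "A' p u \<and> A' p w \<and> u \<noteq> w \<and> ?f u = ?f w"
    have oldadj: "A p z" if "A' p z" "z \<noteq> y" for z using that by (auto simp: A'p split: if_splits)
    consider "u = y" "w \<noteq> y" | "w = y" "u \<noteq> y" | "u \<noteq> y" "w \<noteq> y" using uw by blast
    then show "bag V Tv' p \<inter> bag V Tv' u \<inter> bag V Tv' w = {}"
    proof cases
      case 1
      then show ?thesis using new[of w] uw bag_split_old p old oldadj by (auto simp: Int_ac)
    next
      case 2
      then show ?thesis using new[of u] uw bag_split_old p old oldadj by (auto simp: Int_ac)
    next
      case 3
      then have "A p u" "A p w" "f u = f w" using uw oldadj by auto
      then show ?thesis using sep uw bag_split_old p old by auto
    qed
  qed blast
  then show ?thesis by blast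
qed

end

section \<open>Repeated splitting and the theorem\<close>

lemma reduce_degrees:
  fixes N :: "nat set"
  assumes h: "3 \<le> h" and "path_rep V E N A Tv"
    and "\<And>q. q \<in> N \<Longrightarrow> h < deg_in N A q \<Longrightarrow> \<exists>f. branch_coloring V A Tv h q f"
  shows "\<exists>(N'::nat set) A' Tv'. path_rep V E N' A' Tv' \<and> (\<forall>x\<in>N'. deg_in N' A' x \<le> h)"
  using assms(2,3)
\<comment> \<open>The measure is the total excess over \<open>h\<close>; truncated subtraction makes
  vertices of degree at most \<open>h\<close> count 0.\<close>
proof (induction "\<Sum>x\<in>N. deg_in N A x - h" arbitrary: N A Tv rule: less_induct)
  case less
  show ?case
  proof (cases "\<forall>x\<in>N. deg_in N A x \<le> h")
    case True
    then show ?thesis using less.prems by blast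
  next
    case False
    then obtain q where q: "q \<in> N" "h < deg_in N A q" by auto
    obtain f where f: "branch_coloring V A Tv h q f" using less.prems q by blast
    have fin: "finite N" using path_rep_graph(1)[OF less.prems(1)] .
    have "f ` {x \<in> N. A q x} \<subseteq> {..<h}" using f by (auto simp: branch_coloring_def)
    then have "card (f ` {x \<in> N. A q x}) \<le> h" using card_mono[of "{..<h}"] by simp
    then have "\<not> inj_on f {x \<in> N. A q x}" using q(2) pigeonhole[of f "{x \<in> N. A q x}"] by (simp add: deg_in_def)
    then obtain x1 x2 where x: "A q x1" "A q x2" "x1 \<noteq> x2" "f x1 = f x2" by (auto simp: inj_on_def)
    obtain y where y: "y \<notin> N" using ex_new_if_finite[OF infinite_UNIV_nat fin] by blast
    interpret split V E N A Tv q x1 x2 y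
      by unfold_locales (use less.prems x y f in \<open>auto simp: branch_coloring_def\<close>)
    show ?thesis
    proof (rule less.hyps[OF _ path_rep_split])
      \<comment> \<open>The new vertex has degree at most 3, so its excess is 0.\<close>
      have "(\<Sum>x\<in>insert y N. deg_in (insert y N) A' x - h) = (\<Sum>x\<in>N. deg_in (insert y N) A' x - h)"
        using fin y deg_split_new h by simp
      also have "\<dots> < (\<Sum>x\<in>N. deg_in N A x - h)"
      proof (rule sum_strict_mono_ex1[OF fin])
        show "\<forall>x\<in>N. deg_in (insert y N) A' x - h \<le> deg_in N A x - h" using deg_split_old diff_le_mono by blast
        show "\<exists>x\<in>N. deg_in (insert y N) A' x - h < deg_in N A x - h"
          using q deg_split_center by (intro bexI[of _ q]) auto
      qed
      finally show "(\<Sum>x\<in>insert y N. deg_in (insert y N) A' x - h) < (\<Sum>x\<in>N. deg_in N A x - h)" .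
    next
      fix p assume p: "p \<in> insert y N" "h < deg_in (insert y N) A' p"
      \<comment> \<open>Degrees of old vertices never grow, so a vertex above \<open>h\<close> now
        was above \<open>h\<close> before and already had a colouring.\<close>
      then have "p \<in> N" using deg_split_new h by auto
      moreover have "h < deg_in N A p" using p deg_split_old \<open>p \<in> N\<close> less_le_trans by blast
      ultimately obtain g where "branch_coloring V A Tv h p g" using less.prems by blast
      \<comment> \<open>At \<open>q\<close> the colouring passed on must be \<open>f\<close>, known
        to agree on \<open>x1\<close> and \<open>x2\<close>; elsewhere it is
        \<open>g\<close>.\<close>
      then show "\<exists>f. branch_coloring V A' Tv' h p f"
        using coloring_split[OF \<open>p \<in> N\<close>] f x by metis
    qed
  qed
qed

theorem mainTheorem4:
  fixes V :: "'a set" and E :: "'a \<Rightarrow> 'a \<Rightarrow> bool" and h :: nat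
  assumes "graph V E" and "VPT V E"
  shows "(3 \<le> h \<longrightarrow> (in_hst (enat h) 2 1 V E \<longleftrightarrow>
            (\<forall>C. clique V E C \<longrightarrow> colorable (branch_vertices V E C) (branch_adj V E C) h)))
       \<and> (h = 2 \<longrightarrow> in_hst (enat h) 2 1 V E \<longrightarrow>
            (\<forall>C. clique V E C \<longrightarrow> colorable (branch_vertices V E C) (branch_adj V E C) h))"
proof -
  have fin: "finite V" and sym: "\<And>x y. E x y \<Longrightarrow> E y x"
    using assms(1) by (auto simp: graph_def simple_graph_def)
  \<comment> \<open>Valid for every \<open>h\<close>, so it serves both conjuncts.\<close>
  have necessary: "colorable (branch_vertices V E C) (branch_adj V E C) h"
    if rep: "in_hst (enat h) 2 1 V E" and C: "clique V E C" for C
  proof -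
    obtain N :: "nat set" and A Tv where "path_rep V E N A Tv" "\<forall>x\<in>N. enat (deg_in N A x) \<le> enat h"
      using rep unfolding in_hst_def hst_rep_iff_path_rep by blast
    then show ?thesis using colorable_of_rep[of V E N A Tv h C] fin sym C by simp
  qed
  have sufficient: "in_hst (enat h) 2 1 V E" if h: "3 \<le> h"
    and col: "\<And>C. clique V E C \<Longrightarrow> colorable (branch_vertices V E C) (branch_adj V E C) h"
  proof -
    obtain N0 :: "nat set" and A0 Tv0 where "path_rep V E N0 A0 Tv0"
      using assms(2) unfolding VPT_def in_hst_def hst_rep_iff_path_rep by blast
    from minimal_path_rep[OF this] obtain N :: "nat set" and A Tv where P: "path_rep V E N A Tv"
      and "\<forall>p q. A p q \<longrightarrow> \<not> bag V Tv p \<subseteq> bag V Tv q" by blast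
    then have red: "\<And>p q. A p q \<Longrightarrow> \<not> bag V Tv p \<subseteq> bag V Tv q" by blast
    have "\<exists>f. branch_coloring V A Tv h q f" if "q \<in> N" for q
      using branch_coloring_exists[OF fin P that sym red _ col] h by auto
    then show ?thesis using reduce_degrees[OF h P] unfolding in_hst_def hst_rep_iff_path_rep enat_ord_simps by blast
  qed
  show ?thesis using necessary sufficient by blast
qed

end
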